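(* Let $f:\mathbb{R}^{n_1}\to\mathbb{R}$ and $g:\mathbb{R}^{n_2}\to\mathbb{R}$ be convex, continuously differentiable functions such that $\nabla f$ and $\nabla g$ are locally Lipschitz continuous, and let $t_0\ge1$. Suppose that $\gamma(t)=\frac{\alpha}{t^r}$ with $r\in(-1,1)$ and $\delta(t)=\frac{t}{2r_0}$ satisfy: (a) $r_0>\frac{1+r}{2}$ and $\alpha>\max\{0,(4r_0+r+1)t_0^{r-1}\}$ when $r\in(-1,0]$; (b) $r_0>r$ and $\alpha>\max\{0,(4r_0+2r)t_0^{r-1}\}$ when $r\in(0,1)$. Then for any initial value $(x_0,y_0,\lambda_0,u_0,v_0,w_0)$ there exists a unique solution $(x(t),y(t),\lambda(t))$, with $x\in\mathcal{C}^2([t_0,+\infty),\mathbb{R}^{n_1})$, $y\in\mathcal{C}^2([t_0,+\infty),\mathbb{R}^{n_2})$ and $\lambda\in\mathcal{C}^2([t_0,+\infty),\mathbb{R}^m)$, of the dynamical system (S) (given in the context) satisfying $(x(t_0),y(t_0),\lambda(t_0))=(x_0,y_0,\lambda_0)$ and $(\dot x(t_0),\dot y(t_0),\dot\lambda(t_0))=(u_0,v_0,w_0)$.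
   Context: All spaces are Euclidean with inner product $\langle\cdot,\cdot\rangle$ and norm $\|\cdot\|$. $A\in\mathbb{R}^{m\times n_1}$, $B\in\mathbb{R}^{m\times n_2}$, $b\in\mathbb{R}^m$. It is assumed that there exists at least one $(x^*,y^*,\lambda^* )\in\mathbb{R}^{n_1}\times\mathbb{R}^{n_2}\times\mathbb{R}^m$ with $-A^T\lambda^*=\nabla f(x^* )$, $-B^T\lambda^*=\nabla g(y^* )$, $Ax^*+By^*-b=0$. The dynamical system (S) is $$\begin{cases}\ddot{x}(t)+\gamma(t)\dot{x}(t)=-\nabla f(x(t))-A^T(\lambda(t)+\delta(t)\dot\lambda(t))-A^T(Ax(t)+By(t)-b),\\ \ddot{y}(t)+\gamma(t)\dot{y}(t)=-\nabla g(y(t))-B^T(\lambda(t)+\delta(t)\dot\lambda(t))-B^T(Ax(t)+By(t)-b),\\ \ddot{\lambda}(t)+\gamma(t)\dot{\lambda}(t)=A(x(t)+\delta(t)\dot{x}(t))+B(y(t)+\delta(t)\dot{y}(t))-b.\end{cases}$$ *)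

theory Defs
  imports "HOL-Analysis.Analysis"
begin

definition gradient :: "('a::euclidean_space \<Rightarrow> real) \<Rightarrow> 'a \<Rightarrow> 'a" where
  "gradient f x = (THE D. GDERIV f x :> D)"

lemma gradient_eqI:
  assumes "GDERIV f x :> D"
  shows "gradient f x = D"
  unfolding gradient_def
proof (rule the_equality)
  show "GDERIV f x :> D" by fact
next
  fix D' assume "GDERIV f x :> D'"
  then have "(\<lambda>h. inner h D') = (\<lambda>h. inner h D)"
    using assms unfolding gderiv_def by (rule has_derivative_unique)
  then have "inner h D' = inner h D" for h by (rule fun_cong)
  then show "D' = D" by (subst vector_eq_ldot[symmetric]) blast
qed

lemma GDERIV_gradient:
  fixes f :: "'a::euclidean_space \<Rightarrow> real"
  assumes "f differentiable at x"
  shows "GDERIV f x :> gradient f x"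
proof -
  obtain f' where f': "(f has_derivative f') (at x)"
    using assms unfolding differentiable_def by blast
  then have lin: "linear f'" by (rule has_derivative_linear)
  have "f' = (\<lambda>h. inner h (adjoint f' 1))"
  proof
    fix h show "f' h = inner h (adjoint f' 1)"
      using adjoint_works[OF lin, of h 1] by simp
  qed
  with f' have G: "GDERIV f x :> adjoint f' 1"
    unfolding gderiv_def by (rule back_subst[where P = "\<lambda>F. (f has_derivative F) (at x)"])
  then show ?thesis by (simp only: gradient_eqI[OF G])
qed

definition continuously_differentiable :: "('a::euclidean_space \<Rightarrow> real) \<Rightarrow> bool" where
  "continuously_differentiable f \<longleftrightarrow>
     (\<forall>x. f differentiable at x) \<and> continuous_on UNIV (gradient f)"

text \<open>The time argument of \<^const>\<open>local_lipschitz\<close> is a dummy: the map does not depend on it.\<close>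

definition locally_Lipschitz :: "('a::metric_space \<Rightarrow> 'b::metric_space) \<Rightarrow> bool" where
  "locally_Lipschitz F \<longleftrightarrow> local_lipschitz (UNIV :: real set) UNIV (\<lambda>_. F)"

text \<open>
  Derivatives are taken within the half-line \<open>{t0..}\<close>: they are the usual derivatives
  for \<open>t > t0\<close> and the right derivative at \<open>t0\<close>, and do not depend on the values of
  the (total) function before \<open>t0\<close>.
\<close>

definition D1 :: "real \<Rightarrow> (real \<Rightarrow> 'a::real_normed_vector) \<Rightarrow> real \<Rightarrow> 'a" where
  "D1 t0 x t = vector_derivative x (at t within {t0..})"

definition D2 :: "real \<Rightarrow> (real \<Rightarrow> 'a::real_normed_vector) \<Rightarrow> real \<Rightarrow> 'a" where
  "D2 t0 x = D1 t0 (D1 t0 x)"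

text \<open>Continuity of \<open>x\<close> and \<open>D1 t0 x\<close> follows from their differentiability.\<close>

definition C2_from :: "real \<Rightarrow> (real \<Rightarrow> 'a::real_normed_vector) \<Rightarrow> bool" where
  "C2_from t0 x \<longleftrightarrow>
     x differentiable_on {t0..} \<and> D1 t0 x differentiable_on {t0..} \<and>
     continuous_on {t0..} (D2 t0 x)"

definition solves_system ::
  "(real ^ 'n1 \<Rightarrow> real) \<Rightarrow> (real ^ 'n2 \<Rightarrow> real) \<Rightarrow>
   real ^ 'n1 ^ 'm \<Rightarrow> real ^ 'n2 ^ 'm \<Rightarrow> real ^ 'm \<Rightarrow>
   (real \<Rightarrow> real) \<Rightarrow> (real \<Rightarrow> real) \<Rightarrow> real \<Rightarrow>
   (real \<Rightarrow> real ^ 'n1) \<Rightarrow> (real \<Rightarrow> real ^ 'n2) \<Rightarrow> (real \<Rightarrow> real ^ 'm) \<Rightarrow> bool" where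
  "solves_system f g A B b \<gamma> \<delta> t0 x y l \<longleftrightarrow>
     (\<forall>t\<ge>t0.
        D2 t0 x t + \<gamma> t *\<^sub>R D1 t0 x t =
          - gradient f (x t) - transpose A *v (l t + \<delta> t *\<^sub>R D1 t0 l t)
          - transpose A *v (A *v x t + B *v y t - b) \<and>
        D2 t0 y t + \<gamma> t *\<^sub>R D1 t0 y t =
          - gradient g (y t) - transpose B *v (l t + \<delta> t *\<^sub>R D1 t0 l t)
          - transpose B *v (A *v x t + B *v y t - b) \<and>
        D2 t0 l t + \<gamma> t *\<^sub>R D1 t0 l t =
          A *v (x t + \<delta> t *\<^sub>R D1 t0 x t) + B *v (y t + \<delta> t *\<^sub>R D1 t0 y t) - b)"

definition solves_ivp ::
  "(real ^ 'n1 \<Rightarrow> real) \<Rightarrow> (real ^ 'n2 \<Rightarrow> real) \<Rightarrow>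
   real ^ 'n1 ^ 'm \<Rightarrow> real ^ 'n2 ^ 'm \<Rightarrow> real ^ 'm \<Rightarrow>
   (real \<Rightarrow> real) \<Rightarrow> (real \<Rightarrow> real) \<Rightarrow> real \<Rightarrow>
   real ^ 'n1 \<Rightarrow> real ^ 'n2 \<Rightarrow> real ^ 'm \<Rightarrow>
   real ^ 'n1 \<Rightarrow> real ^ 'n2 \<Rightarrow> real ^ 'm \<Rightarrow>
   (real \<Rightarrow> real ^ 'n1) \<Rightarrow> (real \<Rightarrow> real ^ 'n2) \<Rightarrow> (real \<Rightarrow> real ^ 'm) \<Rightarrow> bool" where
  "solves_ivp f g A B b \<gamma> \<delta> t0 x0 y0 l0 u0 v0 w0 x y l \<longleftrightarrow>
     C2_from t0 x \<and> C2_from t0 y \<and> C2_from t0 l \<and>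
     solves_system f g A B b \<gamma> \<delta> t0 x y l \<and>
     x t0 = x0 \<and> y t0 = y0 \<and> l t0 = l0 \<and>
     D1 t0 x t0 = u0 \<and> D1 t0 y t0 = v0 \<and> D1 t0 l t0 = w0"

end

theory Submission
  imports Defs
begin

text \<open>
  With \<open>z = (x, y, \<lambda>)\<close> the dynamical system has the form
  \<open>z'' = - \<nabla>\<Phi>(z) + N(t, z, z')\<close>, where \<open>\<Phi>(x, y, \<lambda>) = f x + g y\<close> is convex and \<open>N(t, \<cdot>)\<close>
  is affine with coefficients that depend continuously on \<open>t\<close>. As a first-order equation for
  \<open>p = (z, z')\<close> its right-hand side is locally Lipschitz, so solutions are unique and exist locally.
  The gradient of \<open>\<Phi>\<close> may grow faster than linearly, so the real issue is that solutions might blow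
  up in finite time.

  They cannot, because the gradient term is conservative. The energy
  \<open>W = 1 + (\<Phi>(z) - \<Phi>(0) - \<langle>\<nabla>\<Phi>(0), z\<rangle>) + (|z|^2 + |z'|^2)/2\<close> dominates \<open>|p|^2/2\<close>, since the bracket is
  nonnegative by convexity; and along a solution \<open>\<nabla>\<Phi>(z)\<close> cancels from its derivative, which leaves
  \<open>W' = \<langle>z', N - \<nabla>\<Phi>(0) + z\<rangle>\<close>. As \<open>N\<close> grows at most linearly, \<open>W' \<le> K W\<close> on every bounded time
  interval, and Gronwall's inequality bounds \<open>p\<close> there (\<open>energy_estimate\<close>).

  This a priori bound is converted into global existence without a theory of maximal solutions.
  Composing the field with the projection onto a large ball makes it globally Lipschitz, so that
  a single contraction argument solves the modified equation on all of \<open>[a, b]\<close>; a solution that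
  starts inside the ball cannot reach its boundary, because up to the first such time it would solve
  the original equation and obey the a priori bound (\<open>global_solution_if_a_priori_bounded\<close>).
\<close>

section \<open>First-order equations with a globally Lipschitz field\<close>

text \<open>At an end point of an interval the equation holds with the one-sided derivative.\<close>

definition solves_ode_on ::
  "(real \<Rightarrow> 'a::real_normed_vector \<Rightarrow> 'a) \<Rightarrow> real set \<Rightarrow> (real \<Rightarrow> 'a) \<Rightarrow> bool" where
  "solves_ode_on F S \<phi> \<longleftrightarrow> (\<forall>t\<in>S. (\<phi> has_vector_derivative F t (\<phi> t)) (at t within S))"

lemma solves_ode_onD:
  "solves_ode_on F S \<phi> \<Longrightarrow> t \<in> S \<Longrightarrow> (\<phi> has_vector_derivative F t (\<phi> t)) (at t within S)"
  by (simp add: solves_ode_on_def)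

lemma solves_ode_on_subset:
  "solves_ode_on F S \<phi> \<Longrightarrow> S' \<subseteq> S \<Longrightarrow> solves_ode_on F S' \<phi>"
  unfolding solves_ode_on_def by (blast intro: has_vector_derivative_within_subset)

lemma solves_ode_on_continuous_on:
  "solves_ode_on F S \<phi> \<Longrightarrow> continuous_on S \<phi>"
  unfolding solves_ode_on_def
  by (auto intro!: has_vector_derivative_continuous simp: continuous_on_eq_continuous_within)

text \<open>The differential form of Gronwall's inequality: \<open>h t * exp (- K * (t - a))\<close> does not increase.\<close>

lemma gronwall:
  fixes h h' :: "real \<Rightarrow> real"
  assumes "a \<le> b"
    and cont: "continuous_on {a..b} h"
    and der: "\<And>t. a < t \<Longrightarrow> t < b \<Longrightarrow> (h has_real_derivative h' t) (at t)"
    and le: "\<And>t. a < t \<Longrightarrow> t < b \<Longrightarrow> h' t \<le> K * h t"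
  shows "h b \<le> h a * exp (K * (b - a))"
proof -
  have "h b * exp (- K * (b - a)) \<le> h a * exp (- K * (a - a))"
  proof (rule DERIV_nonpos_imp_decreasing_open[OF \<open>a \<le> b\<close>])
    show "continuous_on {a..b} (\<lambda>t. h t * exp (- K * (t - a)))"
      by (intro continuous_intros cont)
    fix t assume t: "a < t" "t < b"
    have "((\<lambda>t. h t * exp (- K * (t - a))) has_real_derivative
            (h' t - K * h t) * exp (- K * (t - a))) (at t)"
      using der[OF t] by (auto intro!: derivative_eq_intros simp: algebra_simps)
    moreover have "(h' t - K * h t) * exp (- K * (t - a)) \<le> 0"
      using le[OF t] by (simp add: mult_le_0_iff)
    ultimately show "\<exists>y. ((\<lambda>t. h t * exp (- K * (t - a))) has_real_derivative y) (at t) \<and> y \<le> 0"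
      by blast
  qed
  then have "h b * exp (- (K * (b - a))) * exp (K * (b - a)) \<le> h a * exp (K * (b - a))"
    by (intro mult_right_mono) auto
  then show ?thesis by (simp add: mult.assoc flip: exp_add)
qed

text \<open>
  The integral operator need not be a contraction for the supremum norm on a long interval. It is
  one, with factor \<open>L / K \<le> 1/2\<close>, for the weighted norm \<open>sup |\<phi> t| exp (- K (t - a))\<close>. The proof applies
  the fixed point theorem to \<open>\<psi> t = exp (- K (t - a)) \<phi> t\<close>, for which the weighted norm becomes the
  usual one, so no small time steps have to be glued.
\<close>

lemma picard_lindeloef_globally_Lipschitz:
  fixes F :: "real \<Rightarrow> 'a::banach \<Rightarrow> 'a"
  assumes "a \<le> b"
    and cont: "continuous_on ({a..b} \<times> UNIV) (\<lambda>(t, z). F t z)"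
    and lip: "\<And>t. t \<in> {a..b} \<Longrightarrow> L-lipschitz_on UNIV (F t)"
  shows "\<exists>\<phi>. \<phi> a = z0 \<and> solves_ode_on F {a..b} \<phi>"
proof -
  \<comment> \<open>The summand \<open>1\<close> keeps \<open>K\<close> positive when \<open>L = 0\<close>.\<close>
  define K where "K = 2 * L + 1"
  have L0: "0 \<le> L" using lip[of a] \<open>a \<le> b\<close> by (auto intro: lipschitz_on_nonneg)
  then have K: "0 < K" "L \<le> K / 2" by (auto simp: K_def)
  define G where "G \<psi> s = F s (exp (K * (s - a)) *\<^sub>R apply_bcontfun \<psi> s)" for \<psi> s
  have contG: "continuous_on {a..b} (G \<psi>)" for \<psi>
  proof -
    have "continuous_on {a..b} (\<lambda>s. (s, exp (K * (s - a)) *\<^sub>R apply_bcontfun \<psi> s))"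
      by (intro continuous_intros) auto
    from continuous_on_compose2[OF cont this] show ?thesis
      by (auto simp: G_def[abs_def])
  qed
  define P where "P \<psi> t = exp (- K * (t - a)) *\<^sub>R (z0 + integral {a..t} (G \<psi>))" for \<psi> t
  have "\<exists>\<omega>. \<forall>t. apply_bcontfun \<omega> t = P \<psi> (clamp a b t)" for \<psi>
  proof -
    have "continuous_on {a..b} (P \<psi>)" unfolding P_def
      by (intro continuous_intros indefinite_integral_continuous_1 integrable_continuous_real contG)
    then have "continuous_on (cbox a b) (P \<psi>)" by simp
    then show ?thesis by (rule continuous_on_cbox_bcontfunE) blast
  qed
  then obtain Q where Q: "\<And>\<psi> t. apply_bcontfun (Q \<psi>) t = P \<psi> (clamp a b t)"
    by metis
  have clamp: "clamp a b t \<in> {a..b}" for t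
    using clamp_in_interval[of a b t] \<open>a \<le> b\<close> by simp
  have contraction: "dist (Q \<psi>) (Q \<omega>) \<le> (1/2) * dist \<psi> \<omega>" for \<psi> \<omega>
  proof (rule dist_bound)
    fix s define t where "t = clamp a b s"
    have t: "t \<in> {a..b}" using clamp t_def by simp
    define d where "d = dist \<psi> \<omega>"
    have d0: "0 \<le> d" by (simp add: d_def)
    have sub: "{a..t} \<subseteq> {a..b}" using t by auto
    have int: "G \<psi> integrable_on {a..t}" for \<psi>
      by (rule integrable_continuous_real, rule continuous_on_subset[OF contG sub])
    have exp_int: "((\<lambda>s. L * d * exp (K * (s - a))) has_integral
        L * d / K * exp (K * (t - a)) - L * d / K * exp (K * (a - a))) {a..t}"
      using t K by (intro fundamental_theorem_of_calculus)
        (auto intro!: derivative_eq_intros simp flip: has_real_derivative_iff_has_vector_derivative)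
    have "norm (integral {a..t} (G \<psi>) - integral {a..t} (G \<omega>))
        = norm (integral {a..t} (\<lambda>s. G \<psi> s - G \<omega> s))"
      by (simp add: integral_diff int)
    also have "\<dots> \<le> integral {a..t} (\<lambda>s. L * d * exp (K * (s - a)))"
    proof (rule integral_norm_bound_integral)
      show "(\<lambda>s. G \<psi> s - G \<omega> s) integrable_on {a..t}" by (intro integrable_diff int)
      show "(\<lambda>s. L * d * exp (K * (s - a))) integrable_on {a..t}" using exp_int by blast
      fix s assume "s \<in> {a..t}"
      then have "s \<in> {a..b}" using sub by blast
      have "norm (G \<psi> s - G \<omega> s) \<le>
          L * dist (exp (K * (s - a)) *\<^sub>R apply_bcontfun \<psi> s) (exp (K * (s - a)) *\<^sub>R apply_bcontfun \<omega> s)"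
        using lipschitz_onD[OF lip[OF \<open>s \<in> {a..b}\<close>]] by (simp add: G_def dist_norm)
      also have "\<dots> = L * (exp (K * (s - a)) * dist (apply_bcontfun \<psi> s) (apply_bcontfun \<omega> s))"
        by (simp add: dist_norm flip: scaleR_diff_right)
      also have "\<dots> \<le> L * (exp (K * (s - a)) * d)"
        unfolding d_def using L0 by (intro mult_left_mono dist_bounded) auto
      finally show "norm (G \<psi> s - G \<omega> s) \<le> L * d * exp (K * (s - a))"
        by (simp add: mult_ac)
    qed
    also have "\<dots> = L * d / K * (exp (K * (t - a)) - 1)"
      unfolding integral_unique[OF exp_int] by (simp add: algebra_simps)
    also have "\<dots> \<le> L * d / K * exp (K * (t - a))"
      using L0 d0 K by (intro mult_left_mono) auto
    also have "\<dots> \<le> d / 2 * exp (K * (t - a))"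
      using mult_right_mono[OF K(2) d0] K by (intro mult_right_mono) (auto simp: field_simps)
    finally have "norm (integral {a..t} (G \<psi>) - integral {a..t} (G \<omega>)) \<le> d / 2 * exp (K * (t - a))" .
    then have "exp (- K * (t - a)) * norm (integral {a..t} (G \<psi>) - integral {a..t} (G \<omega>))
        \<le> exp (- K * (t - a)) * (d / 2 * exp (K * (t - a)))"
      by (rule mult_left_mono) simp
    also have "\<dots> = d / 2" by (simp add: exp_minus)
    finally have "dist (P \<psi> t) (P \<omega> t) \<le> d / 2"
      by (simp add: P_def dist_norm flip: scaleR_diff_right)
    then show "dist (apply_bcontfun (Q \<psi>) s) (apply_bcontfun (Q \<omega>) s) \<le> (1/2) * dist \<psi> \<omega>"
      by (simp add: Q t_def d_def)
  qed
  obtain \<psi> where \<psi>: "Q \<psi> = \<psi>"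
    using banach_fix_type[of "1/2" Q] contraction by auto
  define \<phi> where "\<phi> t = exp (K * (t - a)) *\<^sub>R apply_bcontfun \<psi> t" for t
  have eq: "\<phi> t = z0 + integral {a..t} (\<lambda>s. F s (\<phi> s))" if "t \<in> {a..b}" for t
  proof -
    have "apply_bcontfun \<psi> t = P \<psi> t"
      using Q[of \<psi> t] that by (simp add: \<psi>)
    then show ?thesis
      by (simp add: \<phi>_def P_def G_def[abs_def] flip: exp_add)
  qed
  have "solves_ode_on F {a..b} \<phi>" unfolding solves_ode_on_def
  proof
    fix t assume t: "t \<in> {a..b}"
    have "continuous_on {a..b} (\<lambda>s. F s (\<phi> s))"
      using contG[of \<psi>] by (simp add: G_def[abs_def] \<phi>_def)
    from integral_has_vector_derivative[OF this t]
    have "((\<lambda>t. z0 + integral {a..t} (\<lambda>s. F s (\<phi> s))) has_vector_derivative F t (\<phi> t)) (at t within {a..b})"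
      by (auto intro!: derivative_eq_intros)
    then show "(\<phi> has_vector_derivative F t (\<phi> t)) (at t within {a..b})"
      by (rule has_vector_derivative_transform[OF t, rotated]) (simp add: eq)
  qed
  moreover have "\<phi> a = z0" using eq[of a] \<open>a \<le> b\<close> by simp
  ultimately show ?thesis by blast
qed

text \<open>
  Both solutions stay in a common ball, on which the field has a Lipschitz constant \<open>L\<close>; the squared
  distance of the solutions then satisfies \<open>h' \<le> 2 L h\<close> and vanishes at \<open>a\<close>.
\<close>

lemma solves_ode_on_unique:
  fixes F :: "real \<Rightarrow> 'a::euclidean_space \<Rightarrow> 'a"
  assumes "a \<le> b"
    and lip: "\<And>R. \<exists>L. \<forall>t\<in>{a..b}. L-lipschitz_on (cball 0 R) (F t)"
    and \<phi>: "solves_ode_on F {a..b} \<phi>" and \<psi>: "solves_ode_on F {a..b} \<psi>" and init: "\<phi> a = \<psi> a"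
  shows "\<phi> b = \<psi> b"
proof -
  have "bounded (\<phi> ` {a..b} \<union> \<psi> ` {a..b})"
    unfolding bounded_Un
    by (intro conjI compact_imp_bounded compact_continuous_image solves_ode_on_continuous_on[OF \<phi>]
        solves_ode_on_continuous_on[OF \<psi>]) auto
  then obtain R where "\<forall>z\<in>\<phi> ` {a..b} \<union> \<psi> ` {a..b}. norm z \<le> R" by (auto simp: bounded_iff)
  then have R: "\<phi> t \<in> cball 0 R" "\<psi> t \<in> cball 0 R" if "t \<in> {a..b}" for t using that by auto
  obtain L where L: "\<And>t. t \<in> {a..b} \<Longrightarrow> L-lipschitz_on (cball 0 R) (F t)" using lip by blast
  define d where "d t = \<phi> t - \<psi> t" for t
  define d' where "d' t = F t (\<phi> t) - F t (\<psi> t)" for t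
  have "d b \<bullet> d b \<le> d a \<bullet> d a * exp (2 * L * (b - a))"
  proof (rule gronwall[OF \<open>a \<le> b\<close>])
    show "continuous_on {a..b} (\<lambda>t. d t \<bullet> d t)" unfolding d_def
      by (intro continuous_intros solves_ode_on_continuous_on[OF \<phi>] solves_ode_on_continuous_on[OF \<psi>])
    fix t assume t: "a < t" "t < b"
    then have at: "at t within {a..b} = at t" and mem: "t \<in> {a..b}" by (auto simp: at_within_Icc_at)
    have "(d has_vector_derivative d' t) (at t)" unfolding d_def d'_def
      using solves_ode_onD[OF \<phi> mem] solves_ode_onD[OF \<psi> mem]
      by (auto intro!: derivative_eq_intros simp: at)
    then show "((\<lambda>t. d t \<bullet> d t) has_real_derivative 2 * (d t \<bullet> d' t)) (at t)"
      unfolding has_vector_derivative_def has_field_derivative_def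
      by (auto intro!: derivative_eq_intros simp: inner_commute fun_eq_iff)
    have "d t \<bullet> d' t \<le> norm (d t) * norm (d' t)" by (rule norm_cauchy_schwarz)
    also have "\<dots> \<le> norm (d t) * (L * norm (d t))"
      using lipschitz_onD[OF L[OF mem] R(1)[OF mem] R(2)[OF mem]]
      by (intro mult_left_mono) (auto simp: d_def d'_def dist_norm)
    finally show "2 * (d t \<bullet> d' t) \<le> 2 * L * (d t \<bullet> d t)"
      by (simp add: dot_square_norm power2_eq_square mult_ac)
  qed
  then have "d b \<bullet> d b \<le> 0" using init by (simp add: d_def)
  then have "d b = 0" using inner_gt_zero_iff[of "d b"] by linarith
  then show ?thesis by (simp add: d_def)
qed

section \<open>Global existence from a priori bounds\<close>

text \<open>
  The bound is required of every solution on every initial piece \<open>[a, s]\<close> of \<open>[a, b]\<close>, so that it can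
  be used before the existence of a solution on the whole of \<open>[a, b]\<close> is known: it applies up to the first
  time at which the solution of the truncated equation reaches the boundary of the truncation ball.
\<close>

lemma global_solution_if_a_priori_bounded:
  fixes F :: "real \<Rightarrow> 'a::euclidean_space \<Rightarrow> 'a"
  assumes cont: "continuous_on ({a..} \<times> UNIV) (\<lambda>(t, z). F t z)"
    and lip: "\<And>b R. \<exists>L. \<forall>t\<in>{a..b}. L-lipschitz_on (cball 0 R) (F t)"
    and bound: "\<And>b. a \<le> b \<Longrightarrow>
      \<exists>M. \<forall>s \<phi>. a \<le> s \<and> s \<le> b \<and> \<phi> a = z0 \<and> solves_ode_on F {a..s} \<phi> \<longrightarrow> norm (\<phi> s) \<le> M"
  shows "\<exists>\<phi>. \<phi> a = z0 \<and> solves_ode_on F {a..} \<phi>"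
proof -
  have "\<exists>\<phi>. \<phi> a = z0 \<and> solves_ode_on F {a..b} \<phi>" if "a \<le> b" for b
  proof -
    obtain M where M: "\<And>s \<phi>. a \<le> s \<Longrightarrow> s \<le> b \<Longrightarrow> \<phi> a = z0 \<Longrightarrow> solves_ode_on F {a..s} \<phi> \<Longrightarrow> norm (\<phi> s) \<le> M"
      using bound[OF \<open>a \<le> b\<close>] by blast
    \<comment> \<open>Strictly above the bound, so that a solution obeying it cannot touch the sphere of radius \<open>R\<close>.\<close>
    define R where "R = max M (norm z0) + 1"
    have R: "0 \<le> R" "M < R" "norm z0 < R" using norm_ge_zero[of z0] unfolding R_def by linarith+
    define p where "p = closest_point (cball (0::'a) R)"
    have p_cball: "p z \<in> cball 0 R" for z
      unfolding p_def using R by (intro closest_point_in_set) auto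
    have p_self: "p z = z" if "norm z \<le> R" for z
      using that by (simp add: p_def closest_point_self)
    have p_lip: "1-lipschitz_on UNIV p"
      using R closest_point_lipschitz[of "cball (0::'a) R"] by (auto intro!: lipschitz_onI simp: p_def)
    define H where "H t z = F t (p z)" for t z
    have contH: "continuous_on ({a..b} \<times> UNIV) (\<lambda>(t, z). H t z)"
    proof -
      have "continuous_on ({a..b} \<times> UNIV) (\<lambda>q. (fst q, p (snd q)))"
        by (intro continuous_intros continuous_on_compose2[OF lipschitz_on_continuous_on[OF p_lip]]) auto
      from continuous_on_compose2[OF cont this] show ?thesis by (force simp: H_def case_prod_unfold)
    qed
    obtain L where L: "\<And>t. t \<in> {a..b} \<Longrightarrow> L-lipschitz_on (cball 0 R) (F t)" using lip by blast
    have "L-lipschitz_on UNIV (H t)" if "t \<in> {a..b}" for t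
    proof -
      have "range p \<subseteq> cball 0 R" using p_cball by blast
      from lipschitz_on_compose[OF p_lip lipschitz_on_subset[OF L[OF that] this]] show ?thesis
        by (simp add: H_def[abs_def] o_def)
    qed
    from picard_lindeloef_globally_Lipschitz[OF \<open>a \<le> b\<close> contH this, of z0]
    obtain \<phi> where init: "\<phi> a = z0" and \<phi>: "solves_ode_on H {a..b} \<phi>" by blast
    have H_eq: "H t (\<phi> t) = F t (\<phi> t)" if "norm (\<phi> t) \<le> R" for t
      using that by (simp add: H_def p_self)
    have cont\<phi>: "continuous_on {a..b} (\<lambda>t. norm (\<phi> t))"
      by (intro continuous_intros solves_ode_on_continuous_on[OF \<phi>])
    have "norm (\<phi> t) < R" if "t \<in> {a..b}" for t
    proof (rule ccontr)
      assume "\<not> norm (\<phi> t) < R"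
      define S where "S = {t \<in> {a..b}. R \<le> norm (\<phi> t)}"
      have ne: "S \<noteq> {}" using that \<open>\<not> norm (\<phi> t) < R\<close> by (auto simp: S_def)
      have compact: "compact S"
      proof -
        have "closed ({a..b} \<inter> (\<lambda>t. norm (\<phi> t)) -` {R..})"
          by (rule continuous_closed_preimage[OF cont\<phi>]) auto
        also have "{a..b} \<inter> (\<lambda>t. norm (\<phi> t)) -` {R..} = S" by (auto simp: S_def)
        finally have "closed S" .
        moreover have "bounded S" by (rule bounded_subset[OF bounded_closed_interval]) (auto simp: S_def)
        ultimately show ?thesis by (simp add: compact_eq_bounded_closed)
      qed
      obtain s where s: "s \<in> S" and least: "\<And>t. t \<in> S \<Longrightarrow> s \<le> t"
        using compact_attains_inf[OF compact ne] by auto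
      have "a \<le> s" "s \<le> b" "R \<le> norm (\<phi> s)" using s by (auto simp: S_def)
      \<comment> \<open>The norm at the first exit time \<open>s\<close> is exactly \<open>R\<close>: by continuity it takes the value \<open>R\<close> no later than \<open>s\<close>.\<close>
      obtain u where u: "a \<le> u" "u \<le> s" "norm (\<phi> u) = R"
        using IVT'[of "\<lambda>t. norm (\<phi> t)" a R s] \<open>a \<le> s\<close> \<open>R \<le> norm (\<phi> s)\<close> R init
          continuous_on_subset[OF cont\<phi>, of "{a..s}"] \<open>s \<le> b\<close> by auto
      then have "u \<in> S" using \<open>s \<le> b\<close> by (simp add: S_def)
      then have "norm (\<phi> s) = R" using least u by force
      have "norm (\<phi> t) \<le> R" if "t \<in> {a..s}" for t
      proof (cases "t = s")
        case False
        then have "t \<notin> S" using that least by force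
        then show ?thesis using that \<open>s \<le> b\<close> by (auto simp: S_def)
      qed (use \<open>norm (\<phi> s) = R\<close> in simp)
      then have "solves_ode_on F {a..s} \<phi>"
        using solves_ode_on_subset[OF \<phi>, of "{a..s}"] \<open>s \<le> b\<close> by (simp add: solves_ode_on_def H_eq)
      then have "norm (\<phi> s) \<le> M" using M \<open>a \<le> s\<close> \<open>s \<le> b\<close> init by blast
      then show False using \<open>norm (\<phi> s) = R\<close> R by simp
    qed
    then have "solves_ode_on F {a..b} \<phi>"
      using \<phi> by (simp add: solves_ode_on_def H_eq less_imp_le)
    then show ?thesis using init by blast
  qed
  then obtain \<psi> where init: "\<And>b. a \<le> b \<Longrightarrow> \<psi> b a = z0"
    and \<psi>: "\<And>b. a \<le> b \<Longrightarrow> solves_ode_on F {a..b} (\<psi> b)" by metis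
  \<comment> \<open>By uniqueness the solutions on different intervals agree, so this diagonal restricts to each \<open>\<psi> b\<close>.\<close>
  define \<phi> where "\<phi> t = \<psi> t t" for t
  have eq: "\<phi> t = \<psi> b t" if "a \<le> t" "t \<le> b" for t b
    unfolding \<phi>_def
    by (rule solves_ode_on_unique[of a t F])
       (use that lip init \<psi> in \<open>auto intro: solves_ode_on_subset[OF \<psi>[of b]]\<close>)
  have "solves_ode_on F {a..} \<phi>" unfolding solves_ode_on_def
  proof
    fix t assume "t \<in> {a..}"
    then have t: "t \<in> {a..t + 1}" by simp
    have "(\<phi> has_vector_derivative F t (\<phi> t)) (at t within {a..t + 1})"
      using solves_ode_onD[OF \<psi>[of "t + 1"] t] t
      by (intro has_vector_derivative_transform[OF t, of \<phi> "\<psi> (t + 1)"]) (auto simp: eq[of t "t + 1"] eq)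
    moreover have "at t within {a..t + 1} = at t within {a..}"
      by (rule at_within_nhd[of t "{..<t + 1}"]) auto
    ultimately show "(\<phi> has_vector_derivative F t (\<phi> t)) (at t within {a..})" by simp
  qed
  moreover have "\<phi> a = z0" by (simp add: \<phi>_def init)
  ultimately show ?thesis by blast
qed

section \<open>Second-order systems driven by a convex potential\<close>

text \<open>Restricting to the line through \<open>x\<close> and \<open>y\<close> reduces this to convex functions of one variable.\<close>

lemma convex_on_tangent_le:
  fixes f :: "'a::euclidean_space \<Rightarrow> real"
  assumes convex: "convex_on UNIV f" and der: "GDERIV f x :> D"
  shows "f x + (y - x) \<bullet> D \<le> f y"
proof -
  define h where "h s = f (x + s *\<^sub>R (y - x))" for s :: real
  have "convex_on UNIV h"
  proof (rule convex_onI)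
    fix t u v :: real assume "0 < t" "t < 1"
    have "x + ((1 - t) *\<^sub>R u + t *\<^sub>R v) *\<^sub>R (y - x) =
        (1 - t) *\<^sub>R (x + u *\<^sub>R (y - x)) + t *\<^sub>R (x + v *\<^sub>R (y - x))"
      by (simp add: algebra_simps)
    then show "h ((1 - t) *\<^sub>R u + t *\<^sub>R v) \<le> (1 - t) * h u + t * h v"
      using convex_onD[OF convex, of t] \<open>0 < t\<close> \<open>t < 1\<close> by (simp add: h_def)
  qed simp
  moreover have "(h has_field_derivative (y - x) \<bullet> D) (at 0)"
  proof -
    have "((\<lambda>s. x + s *\<^sub>R (y - x)) has_derivative (\<lambda>s. s *\<^sub>R (y - x))) (at 0)"
      by (auto intro!: derivative_eq_intros)
    moreover have "(f has_derivative (\<lambda>h. h \<bullet> D)) (at (x + 0 *\<^sub>R (y - x)))"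
      using der by (simp add: gderiv_def)
    ultimately have "(h has_derivative (\<lambda>s. (s *\<^sub>R (y - x)) \<bullet> D)) (at 0)"
      unfolding h_def by (rule has_derivative_compose)
    then show ?thesis by (simp add: has_field_derivative_def mult_commute_abs)
  qed
  ultimately have "h 1 - h 0 \<ge> (y - x) \<bullet> D * (1 - 0)"
    by (intro convex_on_imp_above_tangent[of UNIV]) auto
  then show ?thesis by (simp add: h_def)
qed

text \<open>
  The bound is uniform in the solution and its end point \<open>s\<close>, although \<open>G\<close> may grow
  arbitrarily fast: the contribution \<open>- \<langle>v, G z\<rangle>\<close> of the force to the change of kinetic energy is exactly
  compensated by the change \<open>\<langle>v, G z\<rangle>\<close> of the potential. Subtracting the tangent of \<open>\<Phi>\<close> at \<open>0\<close> makes
  the energy nonnegative even when \<open>\<Phi>\<close> is unbounded below, at the cost of a term linear in \<open>v\<close>.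
\<close>

lemma energy_estimate:
  fixes \<Phi> :: "'a::euclidean_space \<Rightarrow> real" and N :: "real \<Rightarrow> 'a \<times> 'a \<Rightarrow> 'a"
  assumes convex: "convex_on UNIV \<Phi>" and grad: "\<And>z. GDERIV \<Phi> z :> G z"
    and "0 \<le> C" and growth: "\<And>t p. t \<in> {a..b} \<Longrightarrow> norm (N t p) \<le> C * (1 + norm p)"
  shows "\<exists>M. \<forall>s \<phi>. a \<le> s \<and> s \<le> b \<and> \<phi> a = p0 \<and>
           solves_ode_on (\<lambda>t p. (snd p, N t p - G (fst p))) {a..s} \<phi> \<longrightarrow> norm (\<phi> s) \<le> M"
proof -
  define W where "W p = 1 + (\<Phi> (fst p) - \<Phi> 0 - fst p \<bullet> G 0) + (p \<bullet> p) / 2" for p :: "'a \<times> 'a"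
  define K where "K = 2 * (2 * C + norm (G 0) + 1)"
  have W_ge: "1 + (norm p)\<^sup>2 / 2 \<le> W p" for p
    using convex_on_tangent_le[OF convex grad, of 0 "fst p"] by (simp add: W_def dot_square_norm)
  have K0: "0 \<le> K" using \<open>0 \<le> C\<close> by (simp add: K_def)
  have W0: "0 \<le> W p" for p using W_ge[of p] by (smt (verit) zero_le_power2 divide_nonneg_nonneg)
  have "norm (\<phi> s) \<le> sqrt (2 * (W p0 * exp (K * (b - a))))"
    if s: "a \<le> s" "s \<le> b" and init: "\<phi> a = p0"
      and \<phi>: "solves_ode_on (\<lambda>t p. (snd p, N t p - G (fst p))) {a..s} \<phi>" for s \<phi>
  proof -
    have contG: "continuous_on UNIV \<Phi>"
      using grad unfolding gderiv_def
      by (auto intro!: has_derivative_continuous_on simp: has_derivative_at_withinI)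
    have "W (\<phi> s) \<le> W (\<phi> a) * exp (K * (s - a))"
    proof (rule gronwall[OF \<open>a \<le> s\<close>])
      have "continuous_on UNIV W" unfolding W_def[abs_def]
        by (intro continuous_intros continuous_on_compose2[OF contG]) auto
      then show "continuous_on {a..s} (\<lambda>t. W (\<phi> t))"
        by (rule continuous_on_compose2) (use solves_ode_on_continuous_on[OF \<phi>] in auto)
      fix t assume t: "a < t" "t < s"
      then have at: "at t within {a..s} = at t" and mem: "t \<in> {a..s}" "t \<in> {a..b}"
        using \<open>s \<le> b\<close> by (auto simp: at_within_Icc_at)
      define z v w where "z = fst (\<phi> t)" and "v = snd (\<phi> t)" and "w = N t (\<phi> t)"
      have \<phi>t: "\<phi> t = (z, v)" by (simp add: z_def v_def)
      have d\<phi>: "(\<phi> has_derivative (\<lambda>h. h *\<^sub>R (v, w - G z))) (at t)"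
        using solves_ode_onD[OF \<phi> mem(1)] by (simp add: at has_vector_derivative_def z_def v_def w_def)
      have "((\<lambda>t. fst (\<phi> t)) has_derivative (\<lambda>h. h *\<^sub>R v)) (at t)"
        using has_derivative_fst[OF d\<phi>] by simp
      moreover have "(\<Phi> has_derivative (\<lambda>h. h \<bullet> G z)) (at (fst (\<phi> t)))"
        using grad[of z] by (simp add: gderiv_def z_def)
      ultimately have d\<Phi>: "((\<lambda>t. \<Phi> (fst (\<phi> t))) has_derivative (\<lambda>h. (h *\<^sub>R v) \<bullet> G z)) (at t)"
        by (rule has_derivative_compose)
      show "((\<lambda>t. W (\<phi> t)) has_real_derivative v \<bullet> (w - G 0 + z)) (at t)"
        unfolding W_def has_field_derivative_def
        by (rule has_derivative_eq_rhs, (rule derivative_intros d\<phi> d\<Phi>)+)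
           (auto simp: fun_eq_iff \<phi>t inner_commute algebra_simps add_divide_distrib diff_divide_distrib)
      \<comment> \<open>The gradient at the current point has disappeared; what is left grows at most quadratically.\<close>
      define n where "n = norm (\<phi> t)"
      have n: "norm z \<le> n" "norm v \<le> n" "0 \<le> n"
        using norm_fst_le[of z v] norm_snd_le[of v z] by (auto simp: n_def \<phi>t)
      have "norm (w - G 0 + z) \<le> norm w + norm (G 0) + norm z"
        using norm_triangle_ineq[of "w - G 0" z] norm_triangle_ineq4[of w "G 0"] by linarith
      also have "\<dots> \<le> C * (1 + n) + norm (G 0) + n"
        using growth[OF mem(2), of "\<phi> t"] n by (simp add: w_def n_def)
      finally have w: "norm (w - G 0 + z) \<le> C * (1 + n) + norm (G 0) + n" .
      have "v \<bullet> (w - G 0 + z) \<le> norm v * norm (w - G 0 + z)" by (rule norm_cauchy_schwarz)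
      also have "\<dots> \<le> n * (C * (1 + n) + norm (G 0) + n)"
        using n w by (intro mult_mono) auto
      also have "\<dots> = (C + norm (G 0)) * n + (C + 1) * n\<^sup>2"
        by (simp add: algebra_simps power2_eq_square)
      also have "\<dots> \<le> (C + norm (G 0)) * (1 + n\<^sup>2) + (C + 1) * (1 + n\<^sup>2)"
      proof -
        have "n \<le> 1 + n\<^sup>2" using sum_squares_ge_zero[of "n - 1" 0] n(3)
          by (simp add: power2_eq_square algebra_simps)
        then show ?thesis using \<open>0 \<le> C\<close> by (intro add_mono mult_left_mono) auto
      qed
      also have "\<dots> = K * ((1 + n\<^sup>2) / 2)" by (simp add: K_def algebra_simps add_divide_distrib)
      also have "\<dots> \<le> K * W (\<phi> t)"
        using K0 W_ge[of "\<phi> t"] by (intro mult_left_mono) (auto simp: n_def)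
      finally show "v \<bullet> (w - G 0 + z) \<le> K * W (\<phi> t)" .
    qed
    also have "\<dots> \<le> W p0 * exp (K * (b - a))"
      using W0[of p0] K0 s by (auto simp: init intro!: mult_left_mono)
    finally have "(norm (\<phi> s))\<^sup>2 \<le> 2 * (W p0 * exp (K * (b - a)))"
      using W_ge[of "\<phi> s"] by simp
    then show ?thesis by (rule real_le_rsqrt)
  qed
  then show ?thesis by blast
qed

text \<open>
  The linear growth of \<open>N\<close> that the energy estimate requires comes from its global Lipschitz constant
  together with the boundedness of \<open>N t 0\<close> on compact time intervals.
\<close>

lemma damped_gradient_system_well_posed:
  fixes \<Phi> :: "'a::euclidean_space \<Rightarrow> real" and G :: "'a \<Rightarrow> 'a"
    and N :: "real \<Rightarrow> 'a \<times> 'a \<Rightarrow> 'a" and p0 :: "'a \<times> 'a"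
  defines "F \<equiv> \<lambda>t p. (snd p, N t p - G (fst p))"
  assumes convex: "convex_on UNIV \<Phi>" and grad: "\<And>z. GDERIV \<Phi> z :> G z"
    and contG: "continuous_on UNIV G" and lipG: "\<And>R. \<exists>L. L-lipschitz_on (cball 0 R) G"
    and contN: "continuous_on ({a..} \<times> UNIV) (\<lambda>(t, p). N t p)"
    and lipN: "\<And>b. \<exists>C. \<forall>t\<in>{a..b}. C-lipschitz_on UNIV (N t)"
  shows "\<exists>\<phi>. \<phi> a = p0 \<and> solves_ode_on F {a..} \<phi> \<and>
           (\<forall>\<psi>. \<psi> a = p0 \<and> solves_ode_on F {a..} \<psi> \<longrightarrow> (\<forall>t\<ge>a. \<psi> t = \<phi> t))"
proof -
  have lipF: "\<exists>L. \<forall>t\<in>{a..b}. L-lipschitz_on (cball 0 R) (F t)" for b R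
  proof -
    obtain L where L: "L-lipschitz_on (cball 0 R) G" using lipG by blast
    obtain C where C: "\<And>t. t \<in> {a..b} \<Longrightarrow> C-lipschitz_on UNIV (N t)" using lipN by blast
    have fst: "1-lipschitz_on (cball (0 :: 'a \<times> 'a) R) fst" and snd: "1-lipschitz_on (cball (0 :: 'a \<times> 'a) R) snd"
      by (rule lipschitz_onI, simp_all add: dist_fst_le dist_snd_le)+
    have "fst ` cball (0 :: 'a \<times> 'a) R \<subseteq> cball 0 R"
      using norm_fst_le order_trans by fastforce
    from lipschitz_on_compose[OF fst lipschitz_on_subset[OF L this]]
    have G: "L-lipschitz_on (cball (0 :: 'a \<times> 'a) R) (\<lambda>p. G (fst p))" by (simp add: o_def)
    have "(sqrt (1\<^sup>2 + (C + L)\<^sup>2))-lipschitz_on (cball 0 R) (F t)" if "t \<in> {a..b}" for t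
      unfolding F_def
      by (intro lipschitz_on_Pair lipschitz_on_diff snd G lipschitz_on_subset[OF C[OF that]]) auto
    then show ?thesis by blast
  qed
  have contF: "continuous_on ({a..} \<times> UNIV) (\<lambda>(t, p). F t p)"
    using contN unfolding F_def case_prod_unfold
    by (intro continuous_intros continuous_on_compose2[OF contG]) auto
  have "\<exists>M. \<forall>s \<phi>. a \<le> s \<and> s \<le> b \<and> \<phi> a = p0 \<and> solves_ode_on F {a..s} \<phi> \<longrightarrow> norm (\<phi> s) \<le> M"
    if "a \<le> b" for b
  proof -
    obtain C where C: "\<And>t. t \<in> {a..b} \<Longrightarrow> C-lipschitz_on UNIV (N t)" using lipN by blast
    have "continuous_on {a..b} (\<lambda>t. N t 0)"
    proof -
      have "continuous_on {a..b} (\<lambda>t. (t, 0 :: 'a \<times> 'a))" by (intro continuous_intros)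
      moreover have "(\<lambda>t. (t, 0 :: 'a \<times> 'a)) ` {a..b} \<subseteq> {a..} \<times> UNIV" by auto
      ultimately show ?thesis using continuous_on_compose2[OF contN] by fastforce
    qed
    then have "bounded ((\<lambda>t. N t 0) ` {a..b})"
      by (intro compact_imp_bounded compact_continuous_image) auto
    then obtain D where D: "0 < D" "\<And>t. t \<in> {a..b} \<Longrightarrow> norm (N t 0) \<le> D"
      by (auto simp: bounded_pos)
    have "norm (N t p) \<le> max C D * (1 + norm p)" if t: "t \<in> {a..b}" for t p
    proof -
      have "norm (N t p) \<le> norm (N t 0) + norm (N t p - N t 0)"
        using norm_triangle_ineq[of "N t 0" "N t p - N t 0"] by simp
      also have "\<dots> \<le> D + C * norm p"
        using lipschitz_onD[OF C[OF t], of p 0] D(2)[OF t] by (simp add: dist_norm)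
      also have "\<dots> \<le> max C D * 1 + max C D * norm p"
        by (intro add_mono mult_right_mono) auto
      finally show ?thesis by (simp add: algebra_simps)
    qed
    then show ?thesis
      using energy_estimate[OF convex grad, of "max C D"] D(1) unfolding F_def by simp
  qed
  from global_solution_if_a_priori_bounded[OF contF lipF this]
  obtain \<phi> where init: "\<phi> a = p0" and \<phi>: "solves_ode_on F {a..} \<phi>" by blast
  have "\<psi> t = \<phi> t" if "\<psi> a = p0" "solves_ode_on F {a..} \<psi>" "a \<le> t" for \<psi> t
    by (rule solves_ode_on_unique[of a t F])
       (use that init \<phi> lipF in \<open>auto intro: solves_ode_on_subset\<close>)
  then show ?thesis using init \<phi> by blast
qed

lemma locally_Lipschitz_imp_lipschitz_on_compact:
  assumes "locally_Lipschitz G" "compact S"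
  shows "\<exists>L. L-lipschitz_on S G"
proof -
  have "local_lipschitz {0 :: real} S (\<lambda>_. G)"
    using assms(1) unfolding locally_Lipschitz_def by (rule local_lipschitz_subset) auto
  from local_lipschitz_compact_implies_lipschitz[OF this assms(2)] show ?thesis
    by (metis continuous_on_const finite.emptyI finite.insertI finite_imp_compact singletonI)
qed

lemma time_dependent_affine_lipschitz:
  fixes K0 K1 K2 :: "'a::real_normed_vector \<Rightarrow> 'b::real_normed_vector" and \<gamma> \<delta> :: "real \<Rightarrow> real"
  assumes K: "bounded_linear K0" "bounded_linear K1" "bounded_linear K2"
    and cont: "continuous_on {a..b} \<gamma>" "continuous_on {a..b} \<delta>"
  shows "\<exists>C. \<forall>t\<in>{a..b}. C-lipschitz_on UNIV (\<lambda>p. K0 p + \<gamma> t *\<^sub>R K1 p + \<delta> t *\<^sub>R K2 p + c)"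
proof -
  obtain B0 B1 B2 where B: "B0-lipschitz_on UNIV K0" "B1-lipschitz_on UNIV K1" "B2-lipschitz_on UNIV K2"
    using K by (meson bounded_linear.lipschitz_boundE)
  have "\<exists>M. \<forall>t\<in>{a..b}. \<bar>\<eta> t\<bar> \<le> M" if "continuous_on {a..b} \<eta>" for \<eta> :: "real \<Rightarrow> real"
    using compact_imp_bounded[OF compact_continuous_image[OF that]] by (auto simp: bounded_iff)
  then obtain g d where gd: "\<And>t. t \<in> {a..b} \<Longrightarrow> \<bar>\<gamma> t\<bar> \<le> g" "\<And>t. t \<in> {a..b} \<Longrightarrow> \<bar>\<delta> t\<bar> \<le> d"
    using cont by meson
  have "(B0 + g * B1 + d * B2 + 0)-lipschitz_on UNIV (\<lambda>p. K0 p + \<gamma> t *\<^sub>R K1 p + \<delta> t *\<^sub>R K2 p + c)"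
    if "t \<in> {a..b}" for t
    using gd[OF that] by (intro lipschitz_intros B) auto
  then show ?thesis by blast
qed

lemma D1_eqI:
  assumes "(x has_vector_derivative d) (at t within {t0..})" "t0 \<le> t"
  shows "D1 t0 x t = d"
  unfolding D1_def
proof (rule vector_derivative_within[OF _ assms(1)])
  have "at_right t \<le> at t within {t0..}" using assms(2) by (intro at_le) auto
  then show "at t within {t0..} \<noteq> bot" by (auto simp: bot_unique)
qed

lemma C2_fromD:
  assumes "C2_from t0 x" "t0 \<le> t"
  shows "(x has_vector_derivative D1 t0 x t) (at t within {t0..})"
    and "(D1 t0 x has_vector_derivative D2 t0 x t) (at t within {t0..})"
  using assms unfolding C2_from_def differentiable_on_def D2_def
  by (metis D1_def atLeast_iff vector_derivative_works)+

text \<open>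
  One-sided derivatives on a half-line are unique, so \<^const>\<open>D1\<close> and \<^const>\<open>D2\<close> are whatever
  derivatives one can exhibit. For a component of a first-order solution, the velocity component \<open>u\<close>
  and the acceleration \<open>w\<close> given by the field serve as these.
\<close>

lemma C2_from_if_derivatives:
  assumes x: "\<And>t. t0 \<le> t \<Longrightarrow> (x has_vector_derivative u t) (at t within {t0..})"
    and u: "\<And>t. t0 \<le> t \<Longrightarrow> (u has_vector_derivative w t) (at t within {t0..})"
    and w: "continuous_on {t0..} w"
  shows "C2_from t0 x" and "\<And>t. t0 \<le> t \<Longrightarrow> D1 t0 x t = u t" and "\<And>t. t0 \<le> t \<Longrightarrow> D2 t0 x t = w t"
proof -
  show D1: "D1 t0 x t = u t" if "t0 \<le> t" for t using x that by (simp add: D1_eqI)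
  have dD1: "(D1 t0 x has_vector_derivative w t) (at t within {t0..})" if "t0 \<le> t" for t
    by (rule has_vector_derivative_transform[OF _ _ u[OF that]]) (use that D1 in auto)
  show D2: "D2 t0 x t = w t" if "t0 \<le> t" for t unfolding D2_def using dD1 that by (simp add: D1_eqI)
  have "continuous_on {t0..} (D2 t0 x)"
    using w by (rule continuous_on_eq) (simp add: D2)
  moreover have "x differentiable_on {t0..}" "D1 t0 x differentiable_on {t0..}"
    using x dD1 by (auto simp: differentiable_on_def intro: differentiableI_vector)
  ultimately show "C2_from t0 x" by (simp add: C2_from_def)
qed

section \<open>The primal-dual system as a first-order equation\<close>

definition joint_objective :: "('a \<Rightarrow> real) \<Rightarrow> ('b \<Rightarrow> real) \<Rightarrow> 'a \<times> 'b \<times> 'c \<Rightarrow> real" where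
  "joint_objective f g z = f (fst z) + g (fst (snd z))"

text \<open>
  The multiplier is not a variable of the potential, so its component is \<open>0\<close>: all forces on it are in
  the affine part of the system.
\<close>

definition joint_gradient ::
  "('a::euclidean_space \<Rightarrow> real) \<Rightarrow> ('b::euclidean_space \<Rightarrow> real) \<Rightarrow> 'a \<times> 'b \<times> 'c \<Rightarrow> 'a \<times> 'b \<times> 'c::zero" where
  "joint_gradient f g z = (gradient f (fst z), gradient g (fst (snd z)), 0)"

lemma convex_on_joint_objective:
  assumes "convex_on UNIV f" "convex_on UNIV g"
  shows "convex_on UNIV (joint_objective f g)"
proof (rule convex_onI)
  fix t :: real and z w :: "'a \<times> 'b \<times> 'c" assume "0 < t" "t < 1"
  then show "joint_objective f g ((1 - t) *\<^sub>R z + t *\<^sub>R w) \<le>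
      (1 - t) * joint_objective f g z + t * joint_objective f g w"
    using convex_onD[OF assms(1), of t "fst z" "fst w"]
      convex_onD[OF assms(2), of t "fst (snd z)" "fst (snd w)"]
    by (simp add: joint_objective_def algebra_simps)
qed simp

lemma GDERIV_joint_objective:
  fixes z :: "'a::euclidean_space \<times> 'b::euclidean_space \<times> 'c::euclidean_space"
  assumes "continuously_differentiable f" "continuously_differentiable g"
  shows "GDERIV (joint_objective f g) z :> joint_gradient f g z"
proof -
  have f: "(f has_derivative (\<lambda>h. h \<bullet> gradient f (fst z))) (at (fst z))"
    and g: "(g has_derivative (\<lambda>h. h \<bullet> gradient g (fst (snd z)))) (at (fst (snd z)))"
    using assms by (auto simp: continuously_differentiable_def simp flip: gderiv_def intro: GDERIV_gradient)
  have "((\<lambda>z. f (fst z)) has_derivative (\<lambda>h. fst h \<bullet> gradient f (fst z))) (at z)"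
    using has_derivative_compose[OF has_derivative_fst[OF has_derivative_ident] f] .
  moreover have "((\<lambda>z. g (fst (snd z))) has_derivative (\<lambda>h. fst (snd h) \<bullet> gradient g (fst (snd z)))) (at z)"
    using has_derivative_compose[OF has_derivative_fst[OF has_derivative_snd[OF has_derivative_ident]] g] .
  ultimately show ?thesis
    unfolding gderiv_def joint_objective_def joint_gradient_def
    by (auto intro!: derivative_eq_intros simp: inner_prod_def)
qed

lemma continuous_on_joint_gradient:
  assumes "continuously_differentiable f" "continuously_differentiable g"
  shows "continuous_on UNIV (joint_gradient f g :: _ \<Rightarrow> 'a::euclidean_space \<times> 'b::euclidean_space \<times> 'c::euclidean_space)"
proof -
  have "continuous_on UNIV (gradient f)" "continuous_on UNIV (gradient g)"
    using assms by (auto simp: continuously_differentiable_def)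
  then show ?thesis unfolding joint_gradient_def[abs_def]
    by (intro continuous_intros) (auto intro!: continuous_intros elim!: continuous_on_compose2)
qed

lemma joint_gradient_lipschitz_on_cball:
  fixes f :: "'a::euclidean_space \<Rightarrow> real" and g :: "'b::euclidean_space \<Rightarrow> real"
  assumes "locally_Lipschitz (gradient f)" "locally_Lipschitz (gradient g)"
  shows "\<exists>L. L-lipschitz_on (cball 0 R) (joint_gradient f g :: _ \<Rightarrow> 'a \<times> 'b \<times> 'c::euclidean_space)"
proof -
  obtain L1 L2 where L1: "L1-lipschitz_on (cball 0 R) (gradient f)" and L2: "L2-lipschitz_on (cball 0 R) (gradient g)"
    using locally_Lipschitz_imp_lipschitz_on_compact[OF assms(1) compact_cball[of 0 R]]
      locally_Lipschitz_imp_lipschitz_on_compact[OF assms(2) compact_cball[of 0 R]] by blast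
  have fst: "fst z \<in> cball 0 R" and fst_snd: "fst (snd z) \<in> cball 0 R"
    if "z \<in> cball 0 R" for z :: "'a \<times> 'b \<times> 'c"
  proof -
    have "norm (fst z) \<le> norm z" "norm (fst (snd z)) \<le> norm (snd z)" "norm (snd z) \<le> norm z"
      by (metis norm_fst_le norm_snd_le prod.collapse)+
    then show "fst z \<in> cball 0 R" "fst (snd z) \<in> cball 0 R" using that by auto
  qed
  have f: "L1-lipschitz_on (cball 0 R) (\<lambda>z :: 'a \<times> 'b \<times> 'c. gradient f (fst z))"
  proof (rule lipschitz_onI)
    fix z w :: "'a \<times> 'b \<times> 'c" assume zw: "z \<in> cball 0 R" "w \<in> cball 0 R"
    have "dist (gradient f (fst z)) (gradient f (fst w)) \<le> L1 * dist (fst z) (fst w)"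
      using zw by (intro lipschitz_onD[OF L1] fst)
    also have "\<dots> \<le> L1 * dist z w"
      using lipschitz_on_nonneg[OF L1] by (intro mult_left_mono dist_fst_le)
    finally show "dist (gradient f (fst z)) (gradient f (fst w)) \<le> L1 * dist z w" .
  qed (rule lipschitz_on_nonneg[OF L1])
  have g: "L2-lipschitz_on (cball 0 R) (\<lambda>z :: 'a \<times> 'b \<times> 'c. gradient g (fst (snd z)))"
  proof (rule lipschitz_onI)
    fix z w :: "'a \<times> 'b \<times> 'c" assume zw: "z \<in> cball 0 R" "w \<in> cball 0 R"
    have "dist (gradient g (fst (snd z))) (gradient g (fst (snd w))) \<le> L2 * dist (fst (snd z)) (fst (snd w))"
      using zw by (intro lipschitz_onD[OF L2] fst_snd)
    also have "\<dots> \<le> L2 * dist z w"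
      using lipschitz_on_nonneg[OF L2] by (intro mult_left_mono order_trans[OF dist_fst_le dist_snd_le])
    finally show "dist (gradient g (fst (snd z))) (gradient g (fst (snd w))) \<le> L2 * dist z w" .
  qed (rule lipschitz_on_nonneg[OF L2])
  show ?thesis
    using lipschitz_on_Pair[OF f lipschitz_on_Pair[OF g lipschitz_on_constant]]
    unfolding joint_gradient_def[abs_def] by blast
qed

text \<open>
  Separating the gradients from the accelerations leaves this force, damping included. It is affine in
  the position \<open>(x, y, l)\<close> and the velocity \<open>(u, v, w)\<close>, so only the gradients can grow
  superlinearly, and they derive from a potential.
\<close>

definition coupling_force ::
  "real ^ 'n1 ^ 'm \<Rightarrow> real ^ 'n2 ^ 'm \<Rightarrow> real ^ 'm \<Rightarrow> (real \<Rightarrow> real) \<Rightarrow> (real \<Rightarrow> real) \<Rightarrow> real \<Rightarrow>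
   ((real ^ 'n1) \<times> (real ^ 'n2) \<times> (real ^ 'm)) \<times> ((real ^ 'n1) \<times> (real ^ 'n2) \<times> (real ^ 'm)) \<Rightarrow>
   (real ^ 'n1) \<times> (real ^ 'n2) \<times> (real ^ 'm)" where
  "coupling_force A B b \<gamma> \<delta> t = (\<lambda>((x, y, l), (u, v, w)).
     (- (transpose A *v (l + \<delta> t *\<^sub>R w)) - transpose A *v (A *v x + B *v y - b) - \<gamma> t *\<^sub>R u,
      - (transpose B *v (l + \<delta> t *\<^sub>R w)) - transpose B *v (A *v x + B *v y - b) - \<gamma> t *\<^sub>R v,
      A *v (x + \<delta> t *\<^sub>R u) + B *v (y + \<delta> t *\<^sub>R v) - b - \<gamma> t *\<^sub>R w))"

lemma continuous_on_matrix_vector_mult [continuous_intros]: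
  fixes A :: "real ^ 'n ^ 'm"
  shows "continuous_on S h \<Longrightarrow> continuous_on S (\<lambda>s. A *v h s)"
  by (rule bounded_linear.continuous_on[OF matrix_vector_mul_bounded_linear])

lemma continuous_on_coupling_force:
  assumes "continuous_on {a..} \<gamma>" "continuous_on {a..} \<delta>"
  shows "continuous_on ({a..} \<times> UNIV) (\<lambda>(t, p). coupling_force A B b \<gamma> \<delta> t p)"
  unfolding coupling_force_def case_prod_unfold
  by (intro continuous_intros continuous_on_compose2[OF assms(1)] continuous_on_compose2[OF assms(2)]) auto

text \<open>
  The force splits into a constant, a fixed linear map, and two linear maps multiplied by \<open>\<gamma> t\<close> and
  \<open>\<delta> t\<close>, which are bounded on compact time intervals.
\<close>

lemma coupling_force_lipschitz:
  fixes A :: "real ^ 'n1 ^ 'm" and B :: "real ^ 'n2 ^ 'm" and \<gamma> \<delta> :: "real \<Rightarrow> real"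
  assumes "continuous_on {a..b} \<gamma>" "continuous_on {a..b} \<delta>"
  shows "\<exists>C. \<forall>t\<in>{a..b}. C-lipschitz_on UNIV (coupling_force A B c \<gamma> \<delta> t)"
proof -
  define K0 :: "((real ^ 'n1) \<times> (real ^ 'n2) \<times> (real ^ 'm)) \<times> ((real ^ 'n1) \<times> (real ^ 'n2) \<times> (real ^ 'm)) \<Rightarrow>
      (real ^ 'n1) \<times> (real ^ 'n2) \<times> (real ^ 'm)"
    where "K0 = (\<lambda>((x, y, l), _). (- (transpose A *v l) - transpose A *v (A *v x + B *v y),
      - (transpose B *v l) - transpose B *v (A *v x + B *v y), A *v x + B *v y))"
  define K1 :: "((real ^ 'n1) \<times> (real ^ 'n2) \<times> (real ^ 'm)) \<times> ((real ^ 'n1) \<times> (real ^ 'n2) \<times> (real ^ 'm)) \<Rightarrow>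
      (real ^ 'n1) \<times> (real ^ 'n2) \<times> (real ^ 'm)"
    where "K1 = (\<lambda>p. - snd p)"
  define K2 :: "((real ^ 'n1) \<times> (real ^ 'n2) \<times> (real ^ 'm)) \<times> ((real ^ 'n1) \<times> (real ^ 'n2) \<times> (real ^ 'm)) \<Rightarrow>
      (real ^ 'n1) \<times> (real ^ 'n2) \<times> (real ^ 'm)"
    where "K2 = (\<lambda>(_, (u, v, w)). (- (transpose A *v w), - (transpose B *v w), A *v u + B *v v))"
  note lin = matrix_vector_right_distrib matrix_vector_mult_diff_distrib matrix_vector_mult_scaleR
  have "linear K0" by (rule linearI) (auto simp: K0_def lin algebra_simps simp del: transpose_matrix_vector)
  moreover have "linear K1" by (rule linearI) (auto simp: K1_def)
  moreover have "linear K2" by (rule linearI) (auto simp: K2_def lin algebra_simps simp del: transpose_matrix_vector)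
  ultimately have bl: "bounded_linear K0" "bounded_linear K1" "bounded_linear K2"
    by (simp_all add: linear_conv_bounded_linear)
  have "coupling_force A B c \<gamma> \<delta> t =
      (\<lambda>p. K0 p + \<gamma> t *\<^sub>R K1 p + \<delta> t *\<^sub>R K2 p + (transpose A *v c, transpose B *v c, - c))" for t
    by (auto simp: fun_eq_iff coupling_force_def K0_def K1_def K2_def lin algebra_simps simp del: transpose_matrix_vector)
  then show ?thesis using time_dependent_affine_lipschitz[OF bl assms] by presburger
qed

definition first_order_field where
  "first_order_field f g A B b \<gamma> \<delta> t p =
     (snd p, coupling_force A B b \<gamma> \<delta> t p - joint_gradient f g (fst p))"

definition trajectory where
  "trajectory t0 x y l t = ((x t, y t, l t), (D1 t0 x t, D1 t0 y t, D1 t0 l t))"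

text \<open>
  This direction of the correspondence transfers uniqueness to the second-order system; its converse
  below transfers existence.
\<close>

lemma trajectory_solves_ode:
  fixes A :: "real ^ 'n1 ^ 'm" and B :: "real ^ 'n2 ^ 'm"
  assumes "solves_ivp f g A B b \<gamma> \<delta> t0 x0 y0 l0 u0 v0 w0 x y l"
  shows "trajectory t0 x y l t0 = ((x0, y0, l0), (u0, v0, w0))"
    and "solves_ode_on (first_order_field f g A B b \<gamma> \<delta>) {t0..} (trajectory t0 x y l)"
proof -
  show "trajectory t0 x y l t0 = ((x0, y0, l0), (u0, v0, w0))"
    using assms by (simp add: solves_ivp_def trajectory_def)
  have C2: "C2_from t0 x" "C2_from t0 y" "C2_from t0 l" and sys: "solves_system f g A B b \<gamma> \<delta> t0 x y l"
    using assms by (auto simp: solves_ivp_def)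
  show "solves_ode_on (first_order_field f g A B b \<gamma> \<delta>) {t0..} (trajectory t0 x y l)"
    unfolding solves_ode_on_def
  proof
    fix t assume "t \<in> {t0..}"
    then have t: "t0 \<le> t" by simp
    have "(trajectory t0 x y l has_vector_derivative
        ((D1 t0 x t, D1 t0 y t, D1 t0 l t), (D2 t0 x t, D2 t0 y t, D2 t0 l t))) (at t within {t0..})"
      unfolding trajectory_def[abs_def]
      by (intro has_vector_derivative_Pair C2_fromD C2 t)
    moreover have "D2 t0 x t = - gradient f (x t) - transpose A *v (l t + \<delta> t *\<^sub>R D1 t0 l t)
          - transpose A *v (A *v x t + B *v y t - b) - \<gamma> t *\<^sub>R D1 t0 x t"
      "D2 t0 y t = - gradient g (y t) - transpose B *v (l t + \<delta> t *\<^sub>R D1 t0 l t)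
          - transpose B *v (A *v x t + B *v y t - b) - \<gamma> t *\<^sub>R D1 t0 y t"
      "D2 t0 l t = A *v (x t + \<delta> t *\<^sub>R D1 t0 x t) + B *v (y t + \<delta> t *\<^sub>R D1 t0 y t) - b - \<gamma> t *\<^sub>R D1 t0 l t"
      using sys t by (simp_all add: solves_system_def eq_diff_eq)
    ultimately show "(trajectory t0 x y l has_vector_derivative
        first_order_field f g A B b \<gamma> \<delta> t (trajectory t0 x y l t)) (at t within {t0..})"
      by (simp add: trajectory_def first_order_field_def coupling_force_def joint_gradient_def algebra_simps)
  qed
qed

lemma solves_ivp_if_solves_ode:
  fixes A :: "real ^ 'n1 ^ 'm" and B :: "real ^ 'n2 ^ 'm"
  assumes contF: "continuous_on ({t0..} \<times> UNIV) (\<lambda>(t, p). first_order_field f g A B b \<gamma> \<delta> t p)"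
    and \<phi>: "solves_ode_on (first_order_field f g A B b \<gamma> \<delta>) {t0..} \<phi>" and init: "\<phi> t0 = ((x0, y0, l0), (u0, v0, w0))"
  shows "solves_ivp f g A B b \<gamma> \<delta> t0 x0 y0 l0 u0 v0 w0
           (\<lambda>t. fst (fst (\<phi> t))) (\<lambda>t. fst (snd (fst (\<phi> t)))) (\<lambda>t. snd (snd (fst (\<phi> t))))"
proof -
  define w where "w t = snd (first_order_field f g A B b \<gamma> \<delta> t (\<phi> t))" for t
  have "continuous_on {t0..} (\<lambda>t. (t, \<phi> t))"
    by (intro continuous_intros solves_ode_on_continuous_on[OF \<phi>])
  from continuous_on_compose2[OF contF this] have contw: "continuous_on {t0..} w"
    unfolding w_def[abs_def] by (auto intro!: continuous_intros)
  have fst: "((\<lambda>t. fst (h t)) has_vector_derivative fst d) (at t within S)"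
    and snd: "((\<lambda>t. snd (h t)) has_vector_derivative snd d) (at t within S)"
    if "(h has_vector_derivative d) (at t within S)"
    for h :: "real \<Rightarrow> 'x::real_normed_vector \<times> 'y::real_normed_vector" and d t S
    using that bounded_linear.has_vector_derivative[OF bounded_linear_fst]
      bounded_linear.has_vector_derivative[OF bounded_linear_snd] by blast+
  have pos: "((\<lambda>t. fst (\<phi> t)) has_vector_derivative snd (\<phi> t)) (at t within {t0..})"
    and vel: "((\<lambda>t. snd (\<phi> t)) has_vector_derivative w t) (at t within {t0..})" if "t0 \<le> t" for t
    using fst[OF solves_ode_onD[OF \<phi>, of t]] snd[OF solves_ode_onD[OF \<phi>, of t]] that
    by (auto simp: first_order_field_def w_def)
  note x = C2_from_if_derivatives[OF fst[OF pos] fst[OF vel] continuous_on_fst[OF contw]]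
  note y = C2_from_if_derivatives[OF fst[OF snd[OF pos]] fst[OF snd[OF vel]]
      continuous_on_fst[OF continuous_on_snd[OF contw]]]
  note l = C2_from_if_derivatives[OF snd[OF snd[OF pos]] snd[OF snd[OF vel]]
      continuous_on_snd[OF continuous_on_snd[OF contw]]]
  have "solves_system f g A B b \<gamma> \<delta> t0
      (\<lambda>t. fst (fst (\<phi> t))) (\<lambda>t. fst (snd (fst (\<phi> t)))) (\<lambda>t. snd (snd (fst (\<phi> t))))"
    unfolding solves_system_def
    by (simp add: x y l w_def first_order_field_def coupling_force_def joint_gradient_def case_prod_unfold)
  then show ?thesis
    by (simp add: solves_ivp_def x y l init)
qed

section \<open>Well-posedness of the primal-dual system\<close>

theorem theorem3p1:
  fixes f :: "real ^ 'n1 \<Rightarrow> real" and g :: "real ^ 'n2 \<Rightarrow> real"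
    and A :: "real ^ 'n1 ^ 'm" and B :: "real ^ 'n2 ^ 'm" and b :: "real ^ 'm"
    and \<gamma> \<delta> :: "real \<Rightarrow> real" and \<alpha> r r0 t0 :: real
    and x0 u0 :: "real ^ 'n1" and y0 v0 :: "real ^ 'n2" and l0 w0 :: "real ^ 'm"
  assumes saddle: "\<exists>xs ys ls. - (transpose A *v ls) = gradient f xs \<and>
                     - (transpose B *v ls) = gradient g ys \<and> A *v xs + B *v ys - b = 0"
    and "convex_on UNIV f" and "convex_on UNIV g"
    and "continuously_differentiable f" and "continuously_differentiable g"
    and "locally_Lipschitz (gradient f)" and "locally_Lipschitz (gradient g)"
    and "t0 \<ge> 1" and "-1 < r" and "r < 1"
    and gamma: "\<And>t. t \<ge> t0 \<Longrightarrow> \<gamma> t = \<alpha> / t powr r"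
    and delta: "\<And>t. t \<ge> t0 \<Longrightarrow> \<delta> t = t / (2 * r0)"
    and a: "r \<le> 0 \<Longrightarrow> r0 > (1 + r) / 2 \<and> \<alpha> > max 0 ((4 * r0 + r + 1) * t0 powr (r - 1))"
    and b: "0 < r \<Longrightarrow> r0 > r \<and> \<alpha> > max 0 ((4 * r0 + 2 * r) * t0 powr (r - 1))"
  shows "\<exists>x y l. solves_ivp f g A B b \<gamma> \<delta> t0 x0 y0 l0 u0 v0 w0 x y l \<and>
           (\<forall>x' y' l'. solves_ivp f g A B b \<gamma> \<delta> t0 x0 y0 l0 u0 v0 w0 x' y' l' \<longrightarrow>
              (\<forall>t\<ge>t0. x' t = x t \<and> y' t = y t \<and> l' t = l t))"
proof -
  have "0 < r0"
    using a b \<open>-1 < r\<close> by (cases "r \<le> 0") auto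
  have "continuous_on {t0..} (\<lambda>t. \<alpha> / t powr r)"
    using \<open>1 \<le> t0\<close> by (intro continuous_intros) auto
  then have cont\<gamma>: "continuous_on {t0..} \<gamma>"
    by (rule continuous_on_eq) (simp add: gamma)
  have "continuous_on {t0..} (\<lambda>t. t / (2 * r0))"
    using \<open>0 < r0\<close> by (intro continuous_intros) auto
  then have cont\<delta>: "continuous_on {t0..} \<delta>"
    by (rule continuous_on_eq) (simp add: delta)
  let ?F = "first_order_field f g A B b \<gamma> \<delta>" and ?p0 = "((x0, y0, l0), (u0, v0, w0))"
  have F_eq: "?F = (\<lambda>t p. (snd p, coupling_force A B b \<gamma> \<delta> t p - joint_gradient f g (fst p)))"
    by (simp add: fun_eq_iff first_order_field_def)
  have contG: "continuous_on UNIV (joint_gradient f g :: (real ^ 'n1) \<times> (real ^ 'n2) \<times> (real ^ 'm) \<Rightarrow> _)"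
    by (rule continuous_on_joint_gradient) fact+
  have contN: "continuous_on ({t0..} \<times> UNIV) (\<lambda>(t, p). coupling_force A B b \<gamma> \<delta> t p)"
    by (rule continuous_on_coupling_force[OF cont\<gamma> cont\<delta>])
  have "\<exists>C. \<forall>t\<in>{t0..T}. C-lipschitz_on UNIV (coupling_force A B b \<gamma> \<delta> t)" for T
    by (intro coupling_force_lipschitz continuous_on_subset[OF cont\<gamma>] continuous_on_subset[OF cont\<delta>]) auto
  from damped_gradient_system_well_posed[OF convex_on_joint_objective[OF assms(2,3)]
      GDERIV_joint_objective[OF assms(4,5)] contG joint_gradient_lipschitz_on_cball[OF assms(6,7)]
      contN this, of ?p0]
  obtain \<phi> where init: "\<phi> t0 = ?p0" and \<phi>: "solves_ode_on ?F {t0..} \<phi>"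
    and unique: "\<And>\<psi> t. \<psi> t0 = ?p0 \<Longrightarrow> solves_ode_on ?F {t0..} \<psi> \<Longrightarrow> t0 \<le> t \<Longrightarrow> \<psi> t = \<phi> t"
    unfolding F_eq by blast
  have contF: "continuous_on ({t0..} \<times> UNIV) (\<lambda>(t, p). ?F t p)"
    using contN unfolding F_eq case_prod_unfold
    by (intro continuous_intros continuous_on_compose2[OF contG]) auto
  show ?thesis
  proof (intro exI conjI allI impI)
    show "solves_ivp f g A B b \<gamma> \<delta> t0 x0 y0 l0 u0 v0 w0
        (\<lambda>t. fst (fst (\<phi> t))) (\<lambda>t. fst (snd (fst (\<phi> t)))) (\<lambda>t. snd (snd (fst (\<phi> t))))"
      by (rule solves_ivp_if_solves_ode[OF contF \<phi> init])
    fix x y l t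
    assume "solves_ivp f g A B b \<gamma> \<delta> t0 x0 y0 l0 u0 v0 w0 x y l" and "t0 \<le> t"
    then have "trajectory t0 x y l t = \<phi> t" by (intro unique trajectory_solves_ode)
    then show "x t = fst (fst (\<phi> t))" "y t = fst (snd (fst (\<phi> t)))" "l t = snd (snd (fst (\<phi> t)))"
      by (simp_all add: trajectory_def flip: \<open>trajectory t0 x y l t = \<phi> t\<close>)
  qed
qed

end
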